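(* For every integer $n \ge 4$, the derangement graph $\Gamma_n$ is vertex pancyclic and pancyclic; that is, every vertex of $\Gamma_n$ lies on a cycle of length $\ell$ for every integer $\ell$ with $3\le \ell\le n!$, and $\Gamma_n$ contains a cycle of every length from $3$ to $n!$.
   Context: Let $S_n$ be the symmetric group on $[n]=\{1,\ldots,n\}$ and let $D_n\subseteq S_n$ be the set of derangements, i.e. permutations with no fixed points. For a finite group $G$ and an inverse-closed subset $S\subseteq G$ with $1\notin S$, the Cayley graph $\Gamma(G,S)$ is the simple graph with vertex set $G$ in which $u,v\in G$ are adjacent if and only if $v=su$ for some $s\in S$. The derangement graph is $\Gamma_n=\Gamma(S_n,D_n)$; equivalently, two vertices $g,h\in S_n$ are adjacent if and only if $g(i)\ne h(i)$ for all $i\in[n]$. A graph of order $N\ge 3$ is pancyclic if it contains a cycle of every length from $3$ to $N$, and vertex pancyclic if every vertex lies on a cycle of each length from $3$ to $N$. *)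

theory Defs
  imports "HOL-Algebra.Sym_Groups" "Graph_Theory.Graph_Theory"
begin

text \<open>
  A finite simple graph is represented by a symmetric loopfree digraph without parallel arcs
  (locale \<^locale>\<open>pair_graph\<close>): an edge is a pair of opposite arcs. In such a digraph a directed
  cycle of length at least 3 is a cycle of the simple graph together with a direction and a
  starting point. (A pair of opposite arcs is a directed cycle of length 2; such cycles play no
  role below.)
\<close>

definition cayley_graph :: "('a, 'b) monoid_scheme \<Rightarrow> 'a set \<Rightarrow> 'a pair_pre_digraph" where
  "cayley_graph G S =
     \<lparr> pverts = carrier G,
       parcs = {(u, v). u \<in> carrier G \<and> v \<in> carrier G \<and> (\<exists>s\<in>S. v = s \<otimes>\<^bsub>G\<^esub> u)} \<rparr>"

lemma (in group) pair_graph_cayley_graph: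
  assumes "finite (carrier G)" and "S \<subseteq> carrier G" and "\<one> \<notin> S" and "\<And>s. s \<in> S \<Longrightarrow> inv s \<in> S"
  shows "pair_graph (cayley_graph G S)"
proof -
  have fin: "finite (parcs (cayley_graph G S))"
    by (rule finite_subset[of _ "carrier G \<times> carrier G"])
       (use assms(1) in \<open>auto simp: cayley_graph_def\<close>)
  have loop: "u \<noteq> s \<otimes> u" if "s \<in> S" "u \<in> carrier G" for s u
    using that assms(2,3) by (metis r_cancel_one' subsetD)
  have sym: "\<exists>t\<in>S. u = t \<otimes> (s \<otimes> u)" if "s \<in> S" "u \<in> carrier G" for s u
    using that assms(2,4) by (intro bexI[of _ "inv s"]) (auto simp: m_assoc[symmetric] subset_iff)
  have "symmetric (with_proj (cayley_graph G S))"
    unfolding symmetric_def by (rule symI) (auto simp: cayley_graph_def intro: sym)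
  then show ?thesis
    using fin assms(1) loop by unfold_locales (auto simp: cayley_graph_def)
qed

definition derangements :: "nat \<Rightarrow> (nat \<Rightarrow> nat) set" where
  "derangements n = {p \<in> carrier (sym_group n). \<forall>i\<in>{1..n}. p i \<noteq> i}"

definition derangement_graph :: "nat \<Rightarrow> (nat \<Rightarrow> nat) pair_pre_digraph" where
  "derangement_graph n = cayley_graph (sym_group n) (derangements n)"

lemma card_pverts_derangement_graph: "card (pverts (derangement_graph n)) = fact n"
  by (simp add: derangement_graph_def cayley_graph_def sym_group_def card_permutations)

lemma derangement_graph_adj_iff:
  "(g, h) \<in> parcs (derangement_graph n) \<longleftrightarrow>
     g permutes {1..n} \<and> h permutes {1..n} \<and> (\<forall>i\<in>{1..n}. g i \<noteq> h i)"
proof (intro iffI conjI)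
  assume "(g, h) \<in> parcs (derangement_graph n)"
  then show "g permutes {1..n}" "h permutes {1..n}" "\<forall>i\<in>{1..n}. g i \<noteq> h i"
    by (auto simp: derangement_graph_def cayley_graph_def derangements_def sym_group_def)
       (metis atLeastAtMost_iff permutes_in_image)
next
  assume *: "g permutes {1..n} \<and> h permutes {1..n} \<and> (\<forall>i\<in>{1..n}. g i \<noteq> h i)"
  define s where "s = h \<circ> Hilbert_Choice.inv g"
  have "s permutes {1..n}"
    unfolding s_def using * by (intro permutes_compose permutes_inv) auto
  moreover have "s i \<noteq> i" if "i \<in> {1..n}" for i
    using * that unfolding s_def
    by (metis comp_apply permutes_inv permutes_in_image permutes_inverses(1))
  moreover have "h = s \<circ> g"
    unfolding s_def using * by (metis comp_assoc comp_id permutes_inv_o(2))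
  ultimately show "(g, h) \<in> parcs (derangement_graph n)"
    using * by (auto simp: derangement_graph_def cayley_graph_def derangements_def sym_group_def)
qed

lemma pair_graph_derangement_graph:
  assumes "n \<ge> 1"
  shows "pair_graph (derangement_graph n)"
proof -
  have fin: "finite (pverts (derangement_graph n))"
    using card_pverts_derangement_graph[of n] by (metis card.infinite fact_nonzero)
  have sub: "parcs (derangement_graph n) \<subseteq>
      pverts (derangement_graph n) \<times> pverts (derangement_graph n)"
    by (auto simp: derangement_graph_def cayley_graph_def)
  have "symmetric (with_proj (derangement_graph n))"
    unfolding symmetric_def by (rule symI) (auto simp: derangement_graph_adj_iff)
  moreover have "fst e \<noteq> snd e" if "e \<in> parcs (derangement_graph n)" for e
    using that assms by (cases e) (auto simp: derangement_graph_adj_iff)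
  ultimately show ?thesis
    using fin sub finite_subset[OF sub] by unfold_locales auto
qed

definition pancyclic :: "('a, 'b) pre_digraph \<Rightarrow> bool" where
  "pancyclic G \<longleftrightarrow> 3 \<le> card (verts G) \<and>
     (\<forall>l. 3 \<le> l \<and> l \<le> card (verts G) \<longrightarrow> (\<exists>c. pre_digraph.cycle G c \<and> length c = l))"

text \<open>A cycle is a list of arcs; the vertices on it are the tails of these arcs.\<close>

definition vertex_pancyclic :: "('a, 'b) pre_digraph \<Rightarrow> bool" where
  "vertex_pancyclic G \<longleftrightarrow> 3 \<le> card (verts G) \<and>
     (\<forall>v\<in>verts G. \<forall>l. 3 \<le> l \<and> l \<le> card (verts G) \<longrightarrow>
        (\<exists>c. pre_digraph.cycle G c \<and> length c = l \<and> v \<in> tail G ` set c))"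

end

theory Submission
  imports Defs
begin

text \<open>
  Let \<open>K\<close> be a sharply transitive group of permutations of \<open>{1..n}\<close>. Two elements of a coset \<open>gK\<close>
  differ everywhere, so the cosets are cliques of size \<open>n\<close>, and the permutations fixing \<open>n\<close> are
  coset representatives. If \<open>h = gt\<close> for a transposition \<open>t\<close>, the cliques \<open>gK\<close> and \<open>hK\<close> are well
  connected: \<open>gk\<close> and \<open>hl\<close> are adjacent unless \<open>k l\<^sup>-\<^sup>1\<close> agrees with \<open>t\<close> somewhere, which excludes at
  most three elements of \<open>K\<close>. Order the cliques by a transposition Gray code of the representatives. A
  cycle through all of the first cliques is extended by replacing one of its edges \<open>xy\<close> in the last
  clique by a detour \<open>x a \<dots> b y\<close> through one, two, or more vertices of the next clique, which gives all
  lengths one after the other. For \<open>n \<ge> 5\<close> the cyclic group serves as \<open>K\<close>; for \<open>n = 4\<close> it is too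
  small, but the Klein four group works since its elements are involutions. Left multiplication
  moves a cycle to any prescribed vertex.
\<close>

section \<open>Cycles in chains of cliques\<close>

definition spanning_path :: "('a \<Rightarrow> 'a \<Rightarrow> bool) \<Rightarrow> 'a set \<Rightarrow> 'a \<Rightarrow> 'a list \<Rightarrow> 'a \<Rightarrow> bool" where
  "spanning_path adj U x zs y \<longleftrightarrow>
     distinct zs \<and> zs \<noteq> [] \<and> set zs = U \<and> successively adj zs \<and> hd zs = x \<and> last zs = y"

text \<open>The cycle lies in \<open>U\<close> without having to span it, since all lengths up to
  \<open>card U\<close> are wanted.\<close>

definition cycle_in :: "('a \<Rightarrow> 'a \<Rightarrow> bool) \<Rightarrow> 'a set \<Rightarrow> 'a list \<Rightarrow> bool" where
  "cycle_in adj U zs \<longleftrightarrow>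
     distinct zs \<and> zs \<noteq> [] \<and> set zs \<subseteq> U \<and> successively adj zs \<and> adj (last zs) (hd zs)"

definition clique :: "('a \<Rightarrow> 'a \<Rightarrow> bool) \<Rightarrow> 'a set \<Rightarrow> bool" where
  "clique adj Q \<longleftrightarrow> finite Q \<and> (\<forall>x\<in>Q. \<forall>y\<in>Q. x \<noteq> y \<longrightarrow> adj x y)"

text \<open>The common neighbour \<open>a\<close> permits a detour x a y through one vertex of
  \<open>Q\<close>; the pair \<open>a\<close>, \<open>b\<close> permits detours through any number
  of vertices from 2 to \<open>card Q\<close>. All \<open>x\<close> are covered because the later
  choice of \<open>x\<close> has to avoid two elements of \<open>P\<close>.\<close>

definition linked :: "('a \<Rightarrow> 'a \<Rightarrow> bool) \<Rightarrow> 'a set \<Rightarrow> 'a set \<Rightarrow> bool" where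
  "linked adj P Q \<longleftrightarrow>
     (\<forall>x\<in>P. \<exists>y\<in>P - {x}. \<exists>a\<in>Q. \<exists>b\<in>Q - {a}. adj x a \<and> adj y a \<and> adj y b)"

lemma cycle_in_mono: "cycle_in adj U zs \<Longrightarrow> U \<subseteq> V \<Longrightarrow> cycle_in adj V zs"
  by (auto simp: cycle_in_def)

lemma spanning_path_rev:
  assumes "symp adj" "spanning_path adj U x zs y"
  shows "spanning_path adj U y (rev zs) x"
proof -
  have "successively (\<lambda>x y. adj y x) zs"
    by (rule successively_mono[of adj])
       (use assms in \<open>auto simp: spanning_path_def dest: sympD\<close>)
  then show ?thesis
    using assms(2) by (simp add: spanning_path_def hd_rev last_rev)
qed

lemma spanning_path_append:
  assumes "spanning_path adj U x zs y" "spanning_path adj V v ws w" "U \<inter> V = {}" "adj y v"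
  shows "spanning_path adj (U \<union> V) x (zs @ ws) w"
  using assms by (auto simp: spanning_path_def successively_append_iff)

section \<open>Paths and cycles inside one clique\<close>

lemma clique_successively:
  assumes "clique adj Q" "distinct zs" "set zs \<subseteq> Q"
  shows "successively adj zs"
proof -
  have "sorted_wrt adj zs"
    using assms(2,3) by (induction zs) (use assms(1) in \<open>force simp: clique_def\<close>)+
  then show ?thesis
    by (rule successively_if_sorted_wrt)
qed

lemma clique_path:
  assumes "clique adj Q" "x \<in> Q" "y \<in> Q" "x \<noteq> y" "2 \<le> l" "l \<le> card Q"
  obtains zs where "spanning_path adj (set zs) x zs y" "set zs \<subseteq> Q" "length zs = l"
proof -
  have fin: "finite Q"
    using assms(1) by (simp add: clique_def)
  have "l - 2 \<le> card (Q - {x, y})"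
    using assms fin by (simp add: card_Diff_subset)
  then obtain R where R: "R \<subseteq> Q - {x, y}" "card R = l - 2" "finite R"
    by (metis obtain_subset_with_card_n)
  obtain rs where rs: "set rs = R" "distinct rs"
    using finite_distinct_list[OF R(3)] by blast
  have len: "length rs = l - 2"
    using rs R(2) distinct_card by fastforce
  have "successively adj (x # rs @ [y])"
    by (rule clique_successively[OF assms(1)]) (use rs R assms in auto)
  then show thesis
    using rs R assms(2-5) len by (intro that[of "x # rs @ [y]"]) (auto simp: spanning_path_def)
qed

lemma clique_spanning_path:
  assumes "clique adj Q" "x \<in> Q" "y \<in> Q" "x \<noteq> y"
  obtains zs where "spanning_path adj Q x zs y"
proof -
  have fin: "finite Q"
    using assms(1) by (simp add: clique_def)
  have "card {x, y} \<le> card Q"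
    using assms fin by (intro card_mono) auto
  then obtain zs where zs: "spanning_path adj (set zs) x zs y" "set zs \<subseteq> Q" "length zs = card Q"
    using assms by (auto elim: clique_path[of adj Q x y "card Q"])
  then have "set zs = Q"
    using fin by (metis card_subset_eq distinct_card spanning_path_def)
  then show thesis
    using zs that by simp
qed

text \<open>A path through older cliques will join \<open>a\<close> to \<open>b\<close>; to make it
  a spanning path from \<open>x\<close> to \<open>y\<close>, \<open>Q\<close> is split into one path
  at \<open>b\<close> and one at \<open>a\<close>. Which of them ends in \<open>x\<close> depends on
  the case, hence the unordered \<open>{u, v}\<close>. For \<open>{x, y} = {a, b}\<close> both paths
  would be single vertices, which the hypothesis on \<open>x\<close> excludes.\<close>

lemma clique_split_path:
  assumes Q: "clique adj Q" and ab: "a \<in> Q" "b \<in> Q" "a \<noteq> b"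
    and xy: "x \<in> Q - {a, b}" "y \<in> Q - {x}"
  obtains U us u V v vs where "spanning_path adj U b us u" "spanning_path adj V v vs a"
    "U \<union> V = Q" "U \<inter> V = {}" "{u, v} = {x, y}" "u \<noteq> v"
proof -
  have sub: "clique adj R" if "R \<subseteq> Q" for R
    using Q that by (auto simp: clique_def intro: finite_subset)
  have sing: "spanning_path adj {z} z [z] z" for z
    by (simp add: spanning_path_def)
  have path: "\<exists>zs. spanning_path adj R u zs v" if "R \<subseteq> Q" "u \<in> R" "v \<in> R" "u \<noteq> v" for R u v
    using clique_spanning_path[OF sub] that by metis
  consider "y = a" | "y = b" | "y \<noteq> a" "y \<noteq> b" by blast
  then show thesis
  proof cases
    case 1
    then obtain us where "spanning_path adj (Q - {a}) b us x"
      using path[of "Q - {a}" b x] ab xy by auto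
    then show thesis
      using 1 ab xy sing by (intro that[of "Q - {a}" us x "{a}" a "[a]"]) auto
  next
    case 2
    then obtain vs where "spanning_path adj (Q - {b}) x vs a"
      using path[of "Q - {b}" x a] ab xy by auto
    then show thesis
      using 2 ab xy sing by (intro that[of "{b}" "[b]" b "Q - {b}" x vs]) auto
  next
    case 3
    then obtain us vs where "spanning_path adj {b, x} b us x"
      "spanning_path adj (Q - {b, x}) y vs a"
      using path[of "{b, x}" b x] path[of "Q - {b, x}" y a] ab xy by auto
    then show thesis
      using 3 ab xy by (intro that[of "{b, x}" us x "Q - {b, x}" y vs]) auto
  qed
qed

lemma clique_cycle:
  assumes "clique adj Q" "3 \<le> l" "l \<le> card Q"
  obtains zs where "cycle_in adj Q zs" "length zs = l"
proof -
  obtain R where R: "R \<subseteq> Q" "card R = l" "finite R"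
    using assms(3) by (metis obtain_subset_with_card_n)
  obtain zs where zs: "set zs = R" "distinct zs"
    using finite_distinct_list[OF R(3)] by blast
  have len: "length zs = l"
    using zs R(2) distinct_card by fastforce
  have "zs \<noteq> []"
    using len assms(2) by auto
  moreover have "last zs \<noteq> hd zs"
    using zs(2) len assms(2) by (cases zs) auto
  ultimately have "adj (last zs) (hd zs)"
    using assms(1) zs(1) R(1) unfolding clique_def by (metis hd_in_set last_in_set subsetD)
  then show thesis
    using that[of zs] zs R len \<open>zs \<noteq> []\<close> clique_successively[OF assms(1) zs(2)]
    by (auto simp: cycle_in_def)
qed

text \<open>
  The invariant \<open>\<exists>a\<in>P. \<exists>b\<in>P - {a}. \<dots>\<close> says that a spanning cycle of \<open>U\<close> passes through the most
  recent clique \<open>P\<close> from \<open>a\<close> to \<open>b\<close> in an order that is still free, so that any edge \<open>xy\<close> of \<open>P\<close> with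
  \<open>x \<notin> {a, b}\<close> can be made an edge of the cycle. A detour through \<open>Q\<close> then replaces that edge.
\<close>

lemma clique_chain_step:
  fixes adj :: "'a \<Rightarrow> 'a \<Rightarrow> bool"
  assumes sym: "symp adj" and Q: "clique adj Q" "3 \<le> card Q" "Q \<inter> U = {}"
    and P: "P \<subseteq> U" "finite U" "3 \<le> card P" "linked adj P Q"
    and cyc: "\<And>l. 3 \<le> l \<Longrightarrow> l \<le> card U \<Longrightarrow> \<exists>zs. cycle_in adj U zs \<and> length zs = l"
    and span: "\<exists>a\<in>P. \<exists>b\<in>P - {a}. \<forall>x\<in>P - {a, b}. \<forall>y\<in>P - {x}. \<exists>zs. spanning_path adj U x zs y"
  shows "\<forall>l. 3 \<le> l \<longrightarrow> l \<le> card (Q \<union> U) \<longrightarrow> (\<exists>zs. cycle_in adj (Q \<union> U) zs \<and> length zs = l)"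
    and "\<exists>a\<in>Q. \<exists>b\<in>Q - {a}. \<forall>x\<in>Q - {a, b}. \<forall>y\<in>Q - {x}. \<exists>zs. spanning_path adj (Q \<union> U) x zs y"
proof -
  have symD: "adj u v \<Longrightarrow> adj v u" for u v
    using sym by (rule sympD)
  obtain p q where pq: "p \<in> P" "q \<in> P - {p}"
    "\<And>x y. x \<in> P - {p, q} \<Longrightarrow> y \<in> P - {x} \<Longrightarrow> \<exists>zs. spanning_path adj U x zs y"
    using span by blast
  have "\<not> P \<subseteq> {p, q}"
    using P(3) card_mono[of "{p, q}" P] pq(2) by auto
  then obtain x where x: "x \<in> P - {p, q}"
    by blast
  then obtain y a b where y: "y \<in> P - {x}" and ab: "a \<in> Q" "b \<in> Q" "a \<noteq> b"
    and adj: "adj x a" "adj y a" "adj y b"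
    using P(4) unfolding linked_def by fastforce
  obtain zs where zs: "spanning_path adj U x zs y"
    using pq(3) x y by blast
  have len: "length zs = card U"
    using zs by (metis distinct_card spanning_path_def)
  show "\<forall>l. 3 \<le> l \<longrightarrow> l \<le> card (Q \<union> U) \<longrightarrow> (\<exists>ws. cycle_in adj (Q \<union> U) ws \<and> length ws = l)"
  proof (intro allI impI)
    fix l assume l: "3 \<le> l" "l \<le> card (Q \<union> U)"
    have card: "card (Q \<union> U) = card Q + card U"
      using Q P(2) by (intro card_Un_disjoint) (auto simp: clique_def)
    \<comment> \<open>Either an old cycle has the length, or the spanning path \<open>zs\<close> is
      closed up through \<open>a\<close> alone, or through a path from \<open>b\<close> to
      \<open>a\<close> in \<open>Q\<close>.\<close>
    consider "l \<le> card U" | "l = card U + 1" | "card U + 2 \<le> l" by linarith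
    then show "\<exists>ws. cycle_in adj (Q \<union> U) ws \<and> length ws = l"
    proof cases
      case 1
      then show ?thesis
        using cyc l cycle_in_mono by (metis Un_upper2)
    next
      case 2
      have "cycle_in adj (Q \<union> U) (zs @ [a])"
        using zs ab adj Q(3) symD
        by (auto simp: cycle_in_def spanning_path_def successively_append_iff)
      then show ?thesis
        using 2 len by (intro exI[of _ "zs @ [a]"]) auto
    next
      case 3
      then have "2 \<le> l - card U" "l - card U \<le> card Q"
        using l card by auto
      then obtain ws where ws: "spanning_path adj (set ws) b ws a" "set ws \<subseteq> Q"
        "length ws = l - card U"
        using clique_path[OF Q(1) ab(2,1) ab(3)[symmetric]] by metis
      have "cycle_in adj (Q \<union> U) (zs @ ws)"
        using zs ab adj Q(3) symD ws
        by (auto simp: cycle_in_def spanning_path_def successively_append_iff)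
      then show ?thesis
        using 3 len ws by (intro exI[of _ "zs @ ws"]) auto
    qed
  qed
  have "\<exists>ws. spanning_path adj (Q \<union> U) x' ws y'"
    if xy': "x' \<in> Q - {a, b}" "y' \<in> Q - {x'}" for x' y'
  proof -
    obtain U' us u V' v vs where us: "spanning_path adj U' b us u"
      and vs: "spanning_path adj V' v vs a"
      and UV: "U' \<union> V' = Q" "U' \<inter> V' = {}" and uv: "{u, v} = {x', y'}"
      using clique_split_path[OF Q(1) ab xy'] by metis
    \<comment> \<open>The route is v ... a in \<open>Q\<close>, then x ... y through all of
      \<open>U\<close>, then b ... u in \<open>Q\<close>.\<close>
    have "spanning_path adj (V' \<union> U) v (vs @ zs) y"
      using spanning_path_append[OF vs zs] UV Q(3) adj symD by blast
    then have "spanning_path adj (V' \<union> U \<union> U') v ((vs @ zs) @ us) u"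
      using UV Q(3) adj by (intro spanning_path_append[OF _ us]) auto
    moreover have "V' \<union> U \<union> U' = Q \<union> U"
      using UV by auto
    ultimately obtain ts where ts: "spanning_path adj (Q \<union> U) v ts u"
      by auto
    then show ?thesis
      using spanning_path_rev[OF sym ts] uv by (auto simp: doubleton_eq_iff)
  qed
  then show "\<exists>a\<in>Q. \<exists>b\<in>Q - {a}. \<forall>x\<in>Q - {a, b}. \<forall>y\<in>Q - {x}. \<exists>zs. spanning_path adj (Q \<union> U) x zs y"
    using ab by blast
qed

text \<open>The newest clique is the head of the list, so prepending is the induction step and
  \<open>hd Qs\<close> is where the next detour starts. Both conclusions are carried together
  because the longer cycles arise from the spanning paths.\<close>

lemma clique_chain:
  fixes adj :: "'a \<Rightarrow> 'a \<Rightarrow> bool"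
  assumes sym: "symp adj" and "Qs \<noteq> []"
    and "\<And>Q. Q \<in> set Qs \<Longrightarrow> clique adj Q \<and> 3 \<le> card Q"
    and "sorted_wrt disjnt Qs" and "successively (\<lambda>Q P. linked adj P Q) Qs"
  shows "(\<forall>l. 3 \<le> l \<longrightarrow> l \<le> card (\<Union> (set Qs)) \<longrightarrow>
            (\<exists>zs. cycle_in adj (\<Union> (set Qs)) zs \<and> length zs = l)) \<and>
         (\<exists>a\<in>hd Qs. \<exists>b\<in>hd Qs - {a}. \<forall>x\<in>hd Qs - {a, b}. \<forall>y\<in>hd Qs - {x}.
            \<exists>zs. spanning_path adj (\<Union> (set Qs)) x zs y)"
  using assms(2-)
proof (induction Qs rule: list_nonempty_induct)
  case (single Q)
  then have Q: "clique adj Q" "3 \<le> card Q" by auto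
  then obtain a b where ab: "a \<in> Q" "b \<in> Q - {a}"
    using card_le_Suc0_iff_eq[of Q] by (fastforce simp: clique_def)
  have "\<exists>zs. spanning_path adj Q x zs y" if "x \<in> Q" "y \<in> Q - {x}" for x y
    using clique_spanning_path[OF Q(1), of x y] that by auto
  then have "\<exists>a\<in>Q. \<exists>b\<in>Q - {a}. \<forall>x\<in>Q - {a, b}. \<forall>y\<in>Q - {x}. \<exists>zs. spanning_path adj Q x zs y"
    using ab by blast
  moreover have "\<exists>zs. cycle_in adj Q zs \<and> length zs = l" if "3 \<le> l" "l \<le> card Q" for l
    using clique_cycle[OF Q(1) that] by metis
  ultimately show ?case
    by simp
next
  case (cons Q Qs)
  let ?U = "\<Union> (set Qs)"
  have fin: "finite ?U"
    using cons.prems by (auto simp: clique_def)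
  have hd: "hd Qs \<in> set Qs"
    using cons.hyps by simp
  have *: "clique adj Q" "3 \<le> card Q" "Q \<inter> ?U = {}" "hd Qs \<subseteq> ?U" "3 \<le> card (hd Qs)"
    "linked adj (hd Qs) Q"
    using cons.prems cons.hyps hd by (fastforce simp: disjnt_def successively_Cons)+
  show ?case
    using clique_chain_step[OF sym *(1-4) fin *(5,6)] cons by (auto simp: successively_Cons)
qed

section \<open>A transposition Gray code\<close>

text \<open>The transposition multiplies from the right: the relation is then invariant under left
  multiplication and has the form that \<open>linked_coset\<close> needs.\<close>

definition swapped :: "'a set \<Rightarrow> ('a \<Rightarrow> 'a) \<Rightarrow> ('a \<Rightarrow> 'a) \<Rightarrow> bool" where
  "swapped S p q \<longleftrightarrow> (\<exists>a\<in>S. \<exists>b\<in>S. a \<noteq> b \<and> q = p \<circ> transpose a b)"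

lemma swapped_comp: "swapped S p q \<Longrightarrow> swapped S (r \<circ> p) (r \<circ> q)"
  by (auto simp: swapped_def comp_assoc)

lemma swapped_mono: "swapped S p q \<Longrightarrow> S \<subseteq> T \<Longrightarrow> swapped T p q"
  by (auto simp: swapped_def)

text \<open>Conjugation by \<open>p\<close> turns a transposition on the left into one on the
  right.\<close>

lemma swapped_transpose_comp:
  assumes "p permutes S" "a \<in> S" "b \<in> S" "a \<noteq> b"
  shows "swapped S p (transpose a b \<circ> p)"
proof -
  have "Hilbert_Choice.inv p a \<in> S" "Hilbert_Choice.inv p b \<in> S" "Hilbert_Choice.inv p a \<noteq> Hilbert_Choice.inv p b"
    using assms permutes_in_image[OF permutes_inv[OF assms(1)]]
      inj_eq[OF permutes_inj[OF permutes_inv[OF assms(1)]]] by auto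
  then show ?thesis
    using transpose_comp_eq[OF permutes_bij[OF assms(1)]] by (auto simp: swapped_def)
qed

text \<open>At \<open>a\<close> the two sides take the values \<open>b\<close> and
  \<open>c\<close>.\<close>

lemma permutes_insert_transpose_unique:
  assumes "a \<notin> S" "p permutes S" "q permutes S" "transpose a b \<circ> p = transpose a c \<circ> q"
  shows "b = c \<and> p = q"
proof -
  have "p a = a" "q a = a"
    using assms(1-3) by (auto simp: permutes_def)
  then have "b = c"
    using assms(4) by (metis comp_apply transpose_apply_first)
  then have "p = q"
    using assms(4) by (metis comp_assoc id_comp transpose_comp_involutory)
  then show ?thesis
    using \<open>b = c\<close> by simp
qed

text \<open>The permutations that send \<open>a\<close> to a given \<open>b\<close> form a block, a
  left translate of a code for \<open>S\<close>. As \<open>IH\<close> gives codes with any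
  prescribed start, each block can be started next to the end of the block before it.\<close>

lemma transposition_gray_code_insert:
  fixes a :: 'a and S :: "'a set" and bs :: "'a list" and p :: "'a \<Rightarrow> 'a"
  assumes a: "a \<notin> S"
    and IH: "\<And>p. p permutes S \<Longrightarrow>
      \<exists>ps. distinct ps \<and> set ps = {p. p permutes S} \<and> ps \<noteq> [] \<and> hd ps = p \<and>
    successively (swapped S) ps"
    and bs: "bs \<noteq> []" "distinct bs" "set bs \<subseteq> insert a S" and "p permutes S"
  shows "\<exists>ps. distinct ps \<and> set ps = {transpose a b \<circ> p |b p. b \<in> set bs \<and> p permutes S} \<and>
    ps \<noteq> [] \<and> hd ps = transpose a (hd bs) \<circ> p \<and>
    successively (swapped (insert a S)) ps"
  using bs \<open>p permutes S\<close>
proof (induction bs arbitrary: p rule: list_nonempty_induct)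
  case (single b)
  obtain ps where ps: "distinct ps" "set ps = {p. p permutes S}" "ps \<noteq> []" "hd ps = p"
    "successively (swapped S) ps"
    using IH[OF single(3)] by blast
  let ?us = "map (\<lambda>p. transpose a b \<circ> p) ps"
  have "successively (swapped (insert a S)) ?us"
    unfolding successively_map
    by (rule successively_mono[OF ps(5)]) (auto intro: swapped_comp swapped_mono)
  moreover have "inj_on (\<lambda>p. transpose a b \<circ> p) (set ps)"
    using permutes_insert_transpose_unique[OF a] ps(2) by (auto intro!: inj_onI)
  then have "distinct ?us"
    using ps(1) by (simp add: distinct_map)
  moreover have "set ?us = {transpose a b' \<circ> p |b' p. b' \<in> set [b] \<and> p permutes S}"
    unfolding set_map ps(2) by (simp only: list.set) blast
  moreover have "hd ?us = transpose a (hd [b]) \<circ> p"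
    by (simp only: hd_map[OF ps(3)] ps(4) list.sel)
  ultimately show ?case
    using ps(3) by (intro exI[of _ ?us] conjI) (assumption | simp)+
next
  case (cons b bs)
  obtain ps where ps: "distinct ps" "set ps = {p. p permutes S}" "ps \<noteq> []" "hd ps = p"
    "successively (swapped S) ps"
    using IH[OF cons(5)] by blast
  define q where "q = last ps"
  have q: "q permutes S"
    using last_in_set[OF ps(3)] ps(2) by (auto simp: q_def)
  define c where "c = hd bs"
  have c: "c \<in> insert a S" "c \<noteq> b" "b \<in> insert a S"
    using cons.prems hd_in_set[OF cons.hyps] by (auto simp: c_def)
  \<comment> \<open>The jump is left multiplication by (b c). If \<open>b\<close> or
    \<open>c\<close> is \<open>a\<close>, then \<open>r = q\<close> works; otherwise
    \<open>r\<close> is (b c) q, because (a c)(b c) = (b c)(a b).\<close>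
  have "\<exists>r. r permutes S \<and> swapped (insert a S) (transpose a b \<circ> q) (transpose a c \<circ> r)"
  proof (cases "b = a \<or> c = a")
    case True
    then have "transpose a c \<circ> q = transpose b c \<circ> (transpose a b \<circ> q)"
      by (auto simp: fun_eq_iff transpose_commute)
    moreover have "transpose a b \<circ> q permutes insert a S"
      using c q by (intro permutes_compose permutes_swap_id) (auto intro: permutes_subset)
    ultimately show ?thesis
      using swapped_transpose_comp[of "transpose a b \<circ> q" "insert a S" b c] c q by metis
  next
    case False
    then have *: "transpose a c \<circ> (transpose b c \<circ> q) = transpose b c \<circ> (transpose a b \<circ> q)"
      using c(2) by (auto simp: fun_eq_iff transpose_def)
    moreover have "transpose a b \<circ> q permutes insert a S"
      using c q by (intro permutes_compose permutes_swap_id) (auto intro: permutes_subset)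
    moreover have "transpose b c \<circ> q permutes S"
      using c q False by (intro permutes_compose permutes_swap_id) auto
    ultimately show ?thesis
      using swapped_transpose_comp[of "transpose a b \<circ> q" "insert a S" b c] c by metis
  qed
  then obtain r where r: "r permutes S" "swapped (insert a S) (transpose a b \<circ> q) (transpose a c \<circ> r)"
    by blast
  have bs: "distinct bs" "set bs \<subseteq> insert a S"
    using cons.prems by auto
  obtain rs where rs: "distinct rs" "rs \<noteq> []" "successively (swapped (insert a S)) rs"
    "hd rs = transpose a c \<circ> r"
    "set rs = {transpose a b \<circ> p |b p. b \<in> set bs \<and> p permutes S}"
    using cons.IH[OF bs r(1)] unfolding c_def by blast
  define us where "us = map (\<lambda>p. transpose a b \<circ> p) ps"
  have us: "distinct us" "set us = {transpose a b \<circ> p |p. p permutes S}"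
    "successively (swapped (insert a S)) us" "us \<noteq> []" "last us = transpose a b \<circ> q"
    "hd us = transpose a b \<circ> p"
  proof -
    show "successively (swapped (insert a S)) us"
      unfolding us_def successively_map
      by (rule successively_mono[OF ps(5)]) (auto intro: swapped_comp swapped_mono)
    have "inj_on (\<lambda>p. transpose a b \<circ> p) (set ps)"
      using permutes_insert_transpose_unique[OF a] ps(2) by (auto intro!: inj_onI)
    then show "distinct us"
      using ps(1) by (simp add: us_def distinct_map)
  qed (use ps in \<open>auto simp: us_def q_def hd_map last_map\<close>)
  have disj: "set us \<inter> set rs = {}"
  proof (intro equalityI subsetI)
    fix x assume "x \<in> set us \<inter> set rs"
    then obtain p\<^sub>1 b' p\<^sub>2 where "x = transpose a b \<circ> p\<^sub>1" "p\<^sub>1 permutes S"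
      "x = transpose a b' \<circ> p\<^sub>2" "p\<^sub>2 permutes S" "b' \<in> set bs"
      unfolding us(2) rs(5) by blast
    then have "b \<in> set bs"
      using permutes_insert_transpose_unique[OF a] by metis
    then show "x \<in> {}"
      using cons.prems by simp
  qed simp
  show ?case
  proof (intro exI[of _ "us @ rs"] conjI)
    show "set (us @ rs) = {transpose a b' \<circ> p |b' p. b' \<in> set (b # bs) \<and> p permutes S}"
      unfolding set_append us(2) rs(5) by (simp only: list.set) blast
    show "hd (us @ rs) = transpose a (hd (b # bs)) \<circ> p"
      using us(4,6) by simp
    show "successively (swapped (insert a S)) (us @ rs)"
      using us rs r(2) by (simp add: successively_append_iff)
  qed (use us(1,4) rs(1) disj in simp_all)
qed

lemma transposition_gray_code:
  fixes S :: "'a set" and p :: "'a \<Rightarrow> 'a"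
  assumes "finite S" "p permutes S"
  shows "\<exists>ps. distinct ps \<and> set ps = {p. p permutes S} \<and> ps \<noteq> [] \<and> hd ps = p \<and>
    successively (swapped S) ps"
  using assms
proof (induction S arbitrary: p rule: finite_induct)
  case empty
  then show ?case
    by (intro exI[of _ "[id]"]) (auto simp: permutes_empty)
next
  case (insert a S)
  define q where "q = transpose a (p a) \<circ> p"
  have q: "q permutes S"
    unfolding q_def using insert.prems by (rule permutes_insert_lemma)
  have p: "p = transpose a (p a) \<circ> q"
    by (simp add: q_def fun_eq_iff)
  have pa: "p a \<in> insert a S"
    using permutes_in_image[OF insert.prems, of a] by simp
  \<comment> \<open>The block with image \<open>p a\<close> goes first so that the code starts at
    \<open>p\<close>; the other images follow in any order.\<close>
  obtain cs where cs: "set cs = insert a S - {p a}" "distinct cs"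
    using finite_distinct_list[of "insert a S - {p a}"] insert.hyps by auto
  have "\<exists>ps. distinct ps \<and> set ps = {transpose a b \<circ> q |b q. b \<in> set (p a # cs) \<and> q permutes S} \<and>
      ps \<noteq> [] \<and> hd ps = transpose a (hd (p a # cs)) \<circ> q \<and> successively (swapped (insert a S)) ps"
  proof (rule transposition_gray_code_insert[OF insert.hyps(2)])
    show "\<exists>ps. distinct ps \<and> set ps = {p. p permutes S} \<and> ps \<noteq> [] \<and> hd ps = p \<and>
        successively (swapped S) ps"
      if "p permutes S" for p
      using insert.IH[OF that] .
  qed (use cs pa q in auto)
  moreover have "{transpose a b \<circ> q |b q. b \<in> set (p a # cs) \<and> q permutes S} = {p. p permutes insert a S}"
    unfolding permutes_insert using cs pa by auto
  ultimately show ?case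
    using p by simp
qed

text \<open>For \<open>A = {1..n}\<close> this is adjacency in the derangement graph, by
  \<open>derangement_graph_adj_iff\<close>.\<close>

definition perm_adj :: "'a set \<Rightarrow> ('a \<Rightarrow> 'a) \<Rightarrow> ('a \<Rightarrow> 'a) \<Rightarrow> bool" where
  "perm_adj A g h \<longleftrightarrow> g permutes A \<and> h permutes A \<and> (\<forall>i\<in>A. g i \<noteq> h i)"

lemma symp_perm_adj: "symp (perm_adj A)"
  by (rule sympI) (auto simp: perm_adj_def)

lemma perm_adj_comp:
  assumes "perm_adj A g h" "p permutes A"
  shows "perm_adj A (p \<circ> g) (p \<circ> h)"
  using assms(1) by (simp add: perm_adj_def permutes_compose[OF _ assms(2)]
      inj_eq[OF permutes_inj[OF assms(2)]])

section \<open>Cosets of a sharply transitive group\<close>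

text \<open>That \<open>K\<close> contains \<open>id\<close> follows from \<open>trans\<close> and
  \<open>free\<close>, as \<open>A\<close> is nonempty.\<close>

locale sharply_transitive =
  fixes A :: "'a set" and K :: "('a \<Rightarrow> 'a) set"
  assumes finite_A: "finite A" and A_nonempty: "A \<noteq> {}"
    and permutes: "k \<in> K \<Longrightarrow> k permutes A"
    and comp_closed: "k \<in> K \<Longrightarrow> l \<in> K \<Longrightarrow> k \<circ> l \<in> K"
    and inv_closed: "k \<in> K \<Longrightarrow> Hilbert_Choice.inv k \<in> K"
    and trans: "i \<in> A \<Longrightarrow> j \<in> A \<Longrightarrow> \<exists>k\<in>K. k i = j"
    and free: "k \<in> K \<Longrightarrow> i \<in> A \<Longrightarrow> k i = i \<Longrightarrow> k = id"
begin

definition coset :: "('a \<Rightarrow> 'a) \<Rightarrow> ('a \<Rightarrow> 'a) set" where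
  "coset g = (\<lambda>k. g \<circ> k) ` K"

text \<open>Freeness is applied to \<open>l^-1 k\<close>, which fixes \<open>i\<close>.\<close>

lemma eqI:
  assumes "k \<in> K" "l \<in> K" "i \<in> A" "k i = l i"
  shows "k = l"
proof -
  have "(Hilbert_Choice.inv l \<circ> k) i = i"
    using permutes_inverses[OF permutes[OF assms(2)]] assms(4) by simp
  then have "Hilbert_Choice.inv l \<circ> k = id"
    using assms by (intro free[of _ i] comp_closed inv_closed)
  then have "l \<circ> (Hilbert_Choice.inv l \<circ> k) = l"
    by simp
  then show ?thesis
    using permutes_inverses[OF permutes[OF assms(2)]] by (simp add: fun_eq_iff)
qed

lemma card_K: "card K = card A"
proof -
  obtain i where i: "i \<in> A"
    using A_nonempty by blast
  have "bij_betw (\<lambda>k. k i) K A"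
    using i trans by (auto simp: bij_betw_def inj_on_def permutes_in_image[OF permutes] intro: eqI)
  then show ?thesis
    by (rule bij_betw_same_card)
qed

lemma card_coset:
  assumes "g permutes A"
  shows "card (coset g) = card A"
proof -
  have "inj_on (\<lambda>k. g \<circ> k) K"
    by (rule inj_on_subset[OF fun.inj_map[OF permutes_inj[OF assms]]]) simp
  then show ?thesis
    by (simp add: coset_def card_image card_K)
qed

lemma clique_coset:
  assumes "g permutes A"
  shows "clique (perm_adj A) (coset g)"
proof -
  have "card (coset g) \<noteq> 0"
    using card_coset[OF assms] finite_A A_nonempty by simp
  then have "finite (coset g)"
    by (rule card_ge_0_finite[OF neq0_conv[THEN iffD1]])
  moreover have "perm_adj A (g \<circ> k) (g \<circ> l)" if "k \<in> K" "l \<in> K" "k \<noteq> l" for k l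
    using that assms eqI
    by (auto simp: perm_adj_def permutes inj_eq[OF permutes_inj[OF assms]] intro: permutes_compose)
  ultimately show ?thesis
    by (auto simp: clique_def coset_def)
qed

text \<open>By freeness \<open>d\<close> has no fixed point in \<open>A\<close>, so it could agree
  with the transposition only at \<open>a\<close> or \<open>b\<close>; the last two hypotheses
  exclude this.\<close>

lemma perm_adj_swapped:
  assumes "g permutes A" "a \<in> A" "b \<in> A" "l \<in> K" "d \<in> K" "d \<noteq> id" "d a \<noteq> b" "d b \<noteq> a"
  shows "perm_adj A (g \<circ> (d \<circ> l)) (g \<circ> transpose a b \<circ> l)"
proof -
  have "d (l i) \<noteq> transpose a b (l i)" if "i \<in> A" for i
  proof -
    have "l i \<in> A"
      using that by (simp add: permutes_in_image[OF permutes[OF assms(4)]])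
    then have "d (l i) \<noteq> l i"
      using free assms by blast
    then show ?thesis
      using assms by (auto simp: transpose_def)
  qed
  then show ?thesis
    unfolding perm_adj_def using assms(1-5)
    by (intro conjI permutes_compose[OF _ assms(1)] permutes_compose[OF permutes] permutes_swap_id ballI permutes)
       (simp_all add: inj_eq[OF permutes_inj[OF assms(1)]])
qed

lemma linked_coset:
  assumes "g permutes A" "a \<in> A" "b \<in> A"
    and d: "d \<in> K" "d \<noteq> id" "d a \<noteq> b" "d b \<noteq> a"
    and e: "e \<in> K" "e \<noteq> id" "e a \<noteq> b" "e b \<noteq> a" and "d \<noteq> e"
  shows "linked (perm_adj A) (coset g) (coset (g \<circ> transpose a b))"
  unfolding linked_def
proof (intro ballI)
  fix x assume "x \<in> coset g"
  then obtain k where k: "k \<in> K" "x = g \<circ> k"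
    by (auto simp: coset_def)
  let ?h = "g \<circ> transpose a b"
  \<comment> \<open>\<open>l\<close> and \<open>m\<close> are the solutions of
    \<open>d l = k\<close> and \<open>d m = e l\<close>.\<close>
  define l where "l = Hilbert_Choice.inv d \<circ> k"
  define m where "m = Hilbert_Choice.inv d \<circ> (e \<circ> l)"
  have lm: "l \<in> K" "m \<in> K"
    using d e k by (auto simp: l_def m_def intro!: comp_closed inv_closed)
  have dl: "d \<circ> l = k" and dm: "d \<circ> m = e \<circ> l"
    using permutes_inverses[OF permutes[OF d(1)]] by (auto simp: l_def m_def fun_eq_iff)
  \<comment> \<open>This inequality separates the two chosen vertices in each of the two
    cosets.\<close>
  have el: "e \<circ> l \<noteq> d \<circ> l"
    using \<open>d \<noteq> e\<close> permutes_surj[OF permutes[OF lm(1)]] by (metis surj_fun_eq comp_apply)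
  have inj: "g \<circ> u = g \<circ> v \<Longrightarrow> u = v" for u v
    by (rule injD[OF fun.inj_map[OF permutes_inj[OF assms(1)]]])
  have inj': "?h \<circ> u = ?h \<circ> v \<Longrightarrow> u = v" for u v
    by (rule injD[OF fun.inj_map[OF permutes_inj[OF permutes_compose[OF
              permutes_swap_id[OF assms(2,3)] assms(1)]]]])
  show "\<exists>y\<in>coset g - {x}. \<exists>p\<in>coset ?h. \<exists>q\<in>coset ?h - {p}.
      perm_adj A x p \<and> perm_adj A y p \<and> perm_adj A y q"
  proof (intro bexI conjI)
    show "perm_adj A x (?h \<circ> l)"
      using perm_adj_swapped[OF assms(1-3) lm(1) d] k dl by simp
    show "perm_adj A (g \<circ> (e \<circ> l)) (?h \<circ> l)"
      by (rule perm_adj_swapped[OF assms(1-3) lm(1) e])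
    show "perm_adj A (g \<circ> (e \<circ> l)) (?h \<circ> m)"
      using perm_adj_swapped[OF assms(1-3) lm(2) d] dm by simp
    show "?h \<circ> m \<in> coset ?h - {?h \<circ> l}"
      using lm el dm dl inj'[of m l] by (auto simp: coset_def)
    show "?h \<circ> l \<in> coset ?h"
      using lm by (auto simp: coset_def)
    show "g \<circ> (e \<circ> l) \<in> coset g - {x}"
      using lm e k el dl inj comp_closed by (auto simp: coset_def)
  qed
qed

text \<open>
  For \<open>5 \<le> card A\<close> at most the three elements \<open>id\<close>, \<open>u\<close> (with \<open>u a = b\<close>) and \<open>v\<close> (with \<open>v b = a\<close>) are
  excluded; if all elements are involutions, then \<open>u = v\<close>, which leaves two elements also for
  \<open>card A = 4\<close>.
\<close>

lemma two_non_swapping: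
  assumes "a \<in> A" "b \<in> A"
    and "5 \<le> card A \<or> 4 \<le> card A \<and> (\<forall>k\<in>K. k \<circ> k = id)"
  obtains d e where "d \<in> K" "d \<noteq> id" "d a \<noteq> b" "d b \<noteq> a"
    "e \<in> K" "e \<noteq> id" "e a \<noteq> b" "e b \<noteq> a" "d \<noteq> e"
proof -
  obtain u v where uv: "u \<in> K" "u a = b" "v \<in> K" "v b = a"
    using trans assms by meson
  have fin: "finite K"
    using card_K finite_A A_nonempty by (metis card.infinite card_0_eq)
  let ?G = "K - {id, u, v}"
  have G: "d \<in> K \<and> d \<noteq> id \<and> d a \<noteq> b \<and> d b \<noteq> a" if "d \<in> ?G" for d
    using that uv assms eqI by blast
  have "u = v" if "\<forall>k\<in>K. k \<circ> k = id"
  proof -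
    have "u b = a"
      using that uv by (metis comp_apply id_apply)
    then show ?thesis
      using eqI uv assms by simp
  qed
  then have "card {id, u, v} + 2 \<le> card K"
    using assms(3) card_K by (auto simp: card_insert_if)
  moreover have "card K - card {id, u, v} \<le> card ?G"
    by (rule diff_card_le_card_Diff) simp
  ultimately have "\<not> card ?G \<le> Suc 0"
    by simp
  then obtain d e where "d \<in> ?G" "e \<in> ?G" "d \<noteq> e"
    using card_le_Suc0_iff_eq[of ?G] fin by auto
  then show thesis
    using that G by blast
qed

section \<open>The cosets partition the symmetric group\<close>

lemma coset_disjnt:
  assumes "z \<in> A" "g permutes A" "g' permutes A" "g z = z" "g' z = z" "g \<noteq> g'"
  shows "disjnt (coset g) (coset g')"
proof -
  have "g = g'" if "k \<in> K" "k' \<in> K" "g \<circ> k = g' \<circ> k'" for k k'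
  proof -
    \<comment> \<open>The point that the common element \<open>g k = g' k'\<close> sends to
      \<open>z\<close>. Both \<open>k\<close> and \<open>k'\<close> send it to \<open>z\<close>, so
      they coincide.\<close>
    let ?i = "Hilbert_Choice.inv k z"
    have i: "?i \<in> A" "k ?i = z"
      using permutes_in_image[OF permutes_inv[OF permutes[OF that(1)]]] assms(1)
        permutes_inverses[OF permutes[OF that(1)]] by auto
    have "g' (k' ?i) = g' z"
      using that(3) i assms by (metis comp_apply)
    then have "k' ?i = z"
      using assms(5) permutes_inj[OF assms(3)] by (metis injD)
    then have "k = k'"
      using eqI that i by metis
    then show ?thesis
      using that permutes_surj[OF permutes[OF that(1)]] by (metis surj_fun_eq comp_apply)
  qed
  then show ?thesis
    using assms(6) by (auto simp: disjnt_def coset_def)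
qed

lemma Union_coset:
  assumes "A = insert z S" "z \<notin> S"
  shows "\<Union> (coset ` {g. g permutes S}) = {p. p permutes A}"
proof (intro equalityI subsetI)
  fix p assume "p \<in> \<Union> (coset ` {g. g permutes S})"
  then obtain g k where "g permutes S" "k \<in> K" "p = g \<circ> k"
    by (auto simp: coset_def)
  then show "p \<in> {p. p permutes A}"
    using permutes permutes_subset[of g S A] assms by (auto intro: permutes_compose)
next
  fix p assume "p \<in> {p. p permutes A}"
  then have p: "p permutes A" by simp
  have z: "z \<in> A"
    using assms by simp
  \<comment> \<open>Chosen so that \<open>p k^-1\<close> fixes \<open>z\<close>.\<close>
  obtain k where k: "k \<in> K" "k (Hilbert_Choice.inv p z) = z"
    using trans z permutes_in_image[OF permutes_inv[OF p]] by meson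
  define g where "g = p \<circ> Hilbert_Choice.inv k"
  have "g permutes A"
    unfolding g_def using p permutes[OF k(1)] by (intro permutes_compose permutes_inv)
  moreover have "g z = z"
    using k permutes_inverses[OF permutes[OF k(1)]] permutes_inverses[OF p]
    by (metis comp_apply g_def)
  ultimately have "g permutes S"
    using assms by (intro permutes_superset[of g A S]) auto
  moreover have "p = g \<circ> k"
    using permutes_inverses[OF permutes[OF k(1)]] by (simp add: g_def fun_eq_iff)
  ultimately show "p \<in> \<Union> (coset ` {g. g permutes S})"
    using k by (auto simp: coset_def)
qed

lemma perm_adj_cycles:
  assumes card: "5 \<le> card A \<or> 4 \<le> card A \<and> (\<forall>k\<in>K. k \<circ> k = id)"
    and l: "3 \<le> l" "l \<le> fact (card A)"
  shows "\<exists>zs. cycle_in (perm_adj A) {p. p permutes A} zs \<and> length zs = l"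
proof -
  obtain z where z: "z \<in> A"
    using A_nonempty by blast
  define S where "S = A - {z}"
  have S: "A = insert z S" "z \<notin> S" "finite S"
    using z finite_A by (auto simp: S_def)
  have A: "p permutes A \<and> p z = z" if "p permutes S" for p
    using that permutes_subset[of p S A] permutes_not_in[OF that S(2)] S by auto
  obtain ps where ps: "distinct ps" "set ps = {p. p permutes S}" "ps \<noteq> []"
    "successively (swapped S) ps"
    using transposition_gray_code[OF S(3) permutes_id] by blast
  let ?Qs = "map coset ps"
  have Un: "\<Union> (set ?Qs) = {p. p permutes A}"
    using Union_coset[OF S(1,2)] ps(2) by simp
  have "sorted_wrt (\<lambda>p q. disjnt (coset p) (coset q)) ps"
    using ps(1) equalityD1[OF ps(2)]
    by (induction ps) (auto intro!: coset_disjnt[OF z] dest: A)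
  then have "sorted_wrt disjnt ?Qs"
    by (simp add: sorted_wrt_map)
  \<comment> \<open>Later list entries are older cliques, so the link runs from \<open>q\<close>
    back to \<open>p\<close>.\<close>
  moreover have "linked (perm_adj A) (coset q) (coset p)"
    if pq: "p permutes S" "q permutes S" "swapped S p q" for p q
  proof -
    obtain a b where ab: "a \<in> A" "b \<in> A" "q = p \<circ> transpose a b"
      using pq(3) S(1) by (auto simp: swapped_def)
    then have "p = q \<circ> transpose a b"
      by (simp add: fun_eq_iff)
    then show ?thesis
      using two_non_swapping[OF ab(1,2) card] linked_coset[of q a b] A pq ab by metis
  qed
  then have "successively (\<lambda>Q P. linked (perm_adj A) P Q) ?Qs"
    unfolding successively_map by (intro successively_mono[OF ps(4)]) (use ps(2) in auto)
  moreover have "clique (perm_adj A) Q \<and> 3 \<le> card Q" if "Q \<in> set ?Qs" for Q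
    using that ps(2) clique_coset card_coset A card by auto
  ultimately show ?thesis
    using clique_chain[OF symp_perm_adj, of ?Qs] l ps(3) unfolding Un
    by (simp add: card_permutations[OF refl finite_A])
qed

end

section \<open>Cyclic and Klein four groups\<close>

text \<open>Addition of \<open>d\<close> modulo \<open>n\<close>, with residues represented by
  \<open>1..n\<close>. Leaving \<open>d\<close> unreduced makes composition plain addition of
  parameters.\<close>

definition rotation :: "nat \<Rightarrow> nat \<Rightarrow> nat \<Rightarrow> nat" where
  "rotation n d i = (if i \<in> {1..n} then (i - 1 + d) mod n + 1 else i)"

lemma rotation_in: "i \<in> {1..n} \<Longrightarrow> rotation n d i \<in> {1..n}"
  by (auto simp: rotation_def Suc_le_eq)

lemma rotation_comp: "rotation n d \<circ> rotation n e = rotation n (d + e)"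
proof
  fix i show "(rotation n d \<circ> rotation n e) i = rotation n (d + e) i"
    using rotation_in[of i n e] by (auto simp: rotation_def mod_simps ac_simps)
qed

lemma rotation_dvd:
  assumes "n dvd d"
  shows "rotation n d = id"
proof
  fix i
  have "(i - 1 + d) mod n = i - 1" if "i \<in> {1..n}"
  proof -
    have "(i - 1 + d) mod n = (i - 1) mod n"
      using mod_add_right_eq[of "i - 1" d n] assms by simp
    also have "\<dots> = i - 1"
      using that by (intro mod_less) auto
    finally show ?thesis .
  qed
  then show "rotation n d i = id i"
    by (auto simp: rotation_def)
qed

lemma sharply_transitive_rotation:
  assumes "n \<ge> 1"
  shows "sharply_transitive {1..n} (range (rotation n))"
proof -
  \<comment> \<open>\<open>d * (n - 1)\<close> represents the negative of \<open>d\<close> modulo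
    \<open>n\<close>.\<close>
  have inv: "rotation n d \<circ> rotation n (d * (n - 1)) = id"
    "rotation n (d * (n - 1)) \<circ> rotation n d = id" for d
  proof -
    have "d + d * (n - 1) = d * n" "d * (n - 1) + d = d * n"
      using assms by (cases n; simp)+
    then show "rotation n d \<circ> rotation n (d * (n - 1)) = id"
      "rotation n (d * (n - 1)) \<circ> rotation n d = id"
      by (simp_all only: rotation_comp) (simp_all add: rotation_dvd)
  qed
  show ?thesis
  proof
    fix k i assume k: "k \<in> range (rotation n)"
    then obtain d where d: "k = rotation n d" by auto
    show "k permutes {1..n}"
      unfolding d
    proof (rule bij_imp_permutes)
      show "bij_betw (rotation n d) {1..n} {1..n}"
        using inv[of d] rotation_in[of _ n]
        by (intro bij_betw_byWitness[where f' = "rotation n (d * (n - 1))"])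
           (auto simp only: fun_eq_iff comp_apply id_apply image_subset_iff)
    qed (auto simp: rotation_def)
    show "Hilbert_Choice.inv k \<in> range (rotation n)"
      using inv_unique_comp[OF inv] by (auto simp: d)
    assume i: "i \<in> {1..n}" "k i = i"
    then have "(i - 1 + d) mod n = (i - 1 + 0) mod n"
      by (auto simp: d rotation_def)
    then have "n dvd d"
      using mod_eq_dvd_iff_nat[of "i - 1" "i - 1 + d" n] by simp
    then show "k = id"
      using rotation_dvd d by simp
  next
    fix i j assume ij: "i \<in> {1..n}" "j \<in> {1..n}"
    \<comment> \<open>The rotation by \<open>j - i\<close> is wanted; adding \<open>n\<close> first
      keeps the subtraction from being cut off at 0.\<close>
    then have "i - 1 + (j + n - i) = (j - 1) + n"
      by auto
    then have "(i - 1 + (j + n - i)) mod n = (j - 1) mod n"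
      by (simp only: mod_add_self2)
    also have "\<dots> = j - 1"
      using ij by (intro mod_less) auto
    finally have "rotation n (j + n - i) i = j"
      using ij unfolding rotation_def by simp
    then show "\<exists>k\<in>range (rotation n). k i = j"
      by blast
  qed (use assms in \<open>auto simp: rotation_comp\<close>)
qed

definition klein :: "(nat \<Rightarrow> nat) set" where
  "klein = {id, transpose 1 2 \<circ> transpose 3 4, transpose 1 3 \<circ> transpose 2 4,
     transpose 1 4 \<circ> transpose 2 3}"

lemma klein_comp: "k \<in> klein \<Longrightarrow> l \<in> klein \<Longrightarrow> k \<circ> l \<in> klein"
proof -
  let ?a = "transpose 1 2 \<circ> transpose 3 4 :: nat \<Rightarrow> nat" and ?b = "transpose 1 3 \<circ> transpose 2 4 :: nat \<Rightarrow> nat"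
    and ?c = "transpose 1 4 \<circ> transpose 2 3 :: nat \<Rightarrow> nat"
  have "?a \<circ> ?a = id" "?a \<circ> ?b = ?c" "?a \<circ> ?c = ?b"
    "?b \<circ> ?a = ?c" "?b \<circ> ?b = id" "?b \<circ> ?c = ?a"
    "?c \<circ> ?a = ?b" "?c \<circ> ?b = ?a" "?c \<circ> ?c = id"
    by (simp_all add: fun_eq_iff transpose_def)
  then show "k \<in> klein \<Longrightarrow> l \<in> klein \<Longrightarrow> k \<circ> l \<in> klein"
    unfolding klein_def by (elim insertE emptyE) (simp_all del: comp_apply)
qed

text \<open>This supplies the second alternative of \<open>two_non_swapping\<close>, where four
  points suffice.\<close>

lemma klein_involution: "k \<in> klein \<Longrightarrow> k \<circ> k = id"
  unfolding klein_def by (elim insertE emptyE) (simp_all add: fun_eq_iff transpose_def)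

lemma sharply_transitive_klein: "sharply_transitive {1..4} klein"
proof -
  have A: "{1..4} = {1, 2, 3, 4 :: nat}"
    by auto
  show ?thesis
  proof
    fix k i assume k: "k \<in> klein"
    show "k permutes {1..4}"
      using k by (auto simp: klein_def permutes_id intro!: permutes_compose permutes_swap_id)
    show "Hilbert_Choice.inv k \<in> klein"
      using inv_unique_comp[OF klein_involution[OF k] klein_involution[OF k]] k by simp
    assume "i \<in> {1..4}" "k i = i"
    then show "k = id"
      using k unfolding A klein_def by (elim insertE emptyE) (simp_all add: transpose_def)
  next
    fix i j :: nat assume "i \<in> {1..4}" "j \<in> {1..4}"
    then show "\<exists>k\<in>klein. k i = j"
      unfolding A klein_def by (elim insertE emptyE) (simp_all add: transpose_def)
  qed (auto simp: klein_comp)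
qed

section \<open>The derangement graph\<close>

lemma permutations_cycles:
  assumes "4 \<le> n" "3 \<le> l" "l \<le> fact n"
  shows "\<exists>zs. cycle_in (perm_adj {1..n}) {p. p permutes {1..n}} zs \<and> length zs = l"
proof (cases "n = 4")
  case True
  interpret sharply_transitive "{1..4}" klein
    by (rule sharply_transitive_klein)
  show ?thesis
    using perm_adj_cycles[of l] klein_involution assms True by simp
next
  case False
  interpret sharply_transitive "{1..n}" "range (rotation n)"
    using assms by (intro sharply_transitive_rotation) simp
  show ?thesis
    using perm_adj_cycles[of l] assms False by simp
qed

text \<open>Left multiplications preserve adjacency by \<open>perm_adj_comp\<close>, and one of them
  takes the head of \<open>zs\<close> to \<open>v\<close>.\<close>

lemma cycle_in_permutations_through:
  assumes "cycle_in (perm_adj A) {p. p permutes A} zs" "v permutes A"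
  obtains ws where "cycle_in (perm_adj A) {p. p permutes A} ws" "length ws = length zs" "hd ws = v"
proof -
  let ?w = "hd zs"
  have w: "?w permutes A"
    using assms(1) by (simp add: cycle_in_def perm_adj_def)
  define p where "p = v \<circ> Hilbert_Choice.inv ?w"
  have p: "p permutes A"
    unfolding p_def using w assms(2) by (intro permutes_compose permutes_inv)
  have hd: "p \<circ> ?w = v"
    using permutes_inverses[OF w] by (simp add: p_def fun_eq_iff)
  have "inj_on (\<lambda>q. p \<circ> q) (set zs)"
    by (rule inj_on_subset[OF fun.inj_map[OF permutes_inj[OF p]]]) simp
  moreover have "successively (perm_adj A) (map (\<lambda>q. p \<circ> q) zs)"
    unfolding successively_map
    by (rule successively_mono[of "perm_adj A"])
       (use assms(1) perm_adj_comp p in \<open>auto simp: cycle_in_def\<close>)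
  ultimately have "cycle_in (perm_adj A) {p. p permutes A} (map (\<lambda>q. p \<circ> q) zs)"
    using assms(1) p perm_adj_comp[of A]
    by (auto simp: cycle_in_def distinct_map hd_map last_map intro!: permutes_compose)
  then show thesis
    using assms(1) hd by (intro that[of "map (\<lambda>q. p \<circ> q) zs"]) (auto simp: cycle_in_def hd_map)
qed

section \<open>From vertex lists to cycles of arcs\<close>

lemma pcas_pawalk_verts_zip:
  "pcas u (zip (u # ws) (ws @ [v])) v \<and> pawalk_verts u (zip (u # ws) (ws @ [v])) = u # ws @ [v]"
  by (induction ws arbitrary: u) auto

lemma set_zip_successively:
  "successively adj (u # ws) \<Longrightarrow> adj (last (u # ws)) v \<Longrightarrow> (x, y) \<in> set (zip (u # ws) (ws @ [v])) \<Longrightarrow> adj x y"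
  by (induction ws arbitrary: u) (auto split: if_splits)

lemma cycle_in_imp_cycle:
  assumes "cycle_in (\<lambda>x y. (x, y) \<in> parcs G) (pverts G) zs"
  obtains c where "pre_digraph.cycle (with_proj G) c" "length c = length zs" "hd zs \<in> fst ` set c"
proof -
  obtain u ws where zs: "zs = u # ws"
    using assms by (cases zs) (auto simp: cycle_in_def)
  \<comment> \<open>Zipping the list with its cyclic shift yields the arcs, the closing one last.
    Without its start the vertex list of this walk is \<open>ws @ [u]\<close>, so the distinctness
    demanded of a cycle is that of \<open>zs\<close>.\<close>
  let ?c = "zip (u # ws) (ws @ [u])"
  have "set ?c \<subseteq> parcs G"
  proof
    fix e assume "e \<in> set ?c"
    then have "(fst e, snd e) \<in> set ?c" by simp
    then show "e \<in> parcs G"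
      using set_zip_successively[of "\<lambda>x y. (x, y) \<in> parcs G" u ws u "fst e" "snd e"] assms
      unfolding cycle_in_def zs by simp
  qed
  then have "pre_digraph.cycle (with_proj G) ?c"
    using assms pcas_pawalk_verts_zip[of u ws u]
    by (auto simp: pre_digraph.cycle_def pre_digraph.awalk_def cas_with_proj_eq
        awalk_verts_with_proj_eq cycle_in_def zs intro!: exI[of _ u])
  moreover have "u \<in> fst ` set ?c"
    by (cases ws) auto
  ultimately show thesis
    using that[of ?c] zs by simp
qed

lemma derangement_graph_cycle_through:
  assumes "4 \<le> n" "v \<in> pverts (derangement_graph n)" "3 \<le> l" "l \<le> fact n"
  shows "\<exists>c. pre_digraph.cycle (with_proj (derangement_graph n)) c \<and> length c = l \<and> v \<in> fst ` set c"
proof -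
  have verts: "pverts (derangement_graph n) = {p. p permutes {1..n}}"
    by (simp add: derangement_graph_def cayley_graph_def sym_group_def)
  have adj: "perm_adj {1..n} = (\<lambda>x y. (x, y) \<in> parcs (derangement_graph n))"
    by (simp add: fun_eq_iff perm_adj_def derangement_graph_adj_iff)
  obtain zs where zs: "cycle_in (perm_adj {1..n}) {p. p permutes {1..n}} zs" "length zs = l"
    using permutations_cycles assms by metis
  then obtain ws where ws: "cycle_in (perm_adj {1..n}) {p. p permutes {1..n}} ws" "length ws = l" "hd ws = v"
    using assms(2) verts cycle_in_permutations_through[of "{1..n}" zs v] by (metis mem_Collect_eq)
  have "cycle_in (\<lambda>x y. (x, y) \<in> parcs (derangement_graph n)) (pverts (derangement_graph n)) ws"
    using ws(1) by (simp only: adj verts)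
  then obtain c where "pre_digraph.cycle (with_proj (derangement_graph n)) c" "length c = length ws"
    "hd ws \<in> fst ` set c"
    by (rule cycle_in_imp_cycle)
  then show ?thesis
    using ws(2,3) by blast
qed

theorem corollary1p2:
  fixes n :: nat
  assumes "n \<ge> 4"
  shows "vertex_pancyclic (with_proj (derangement_graph n)) \<and>
         pancyclic (with_proj (derangement_graph n))"
proof -
  have "(3::nat) \<le> fact 4"
    by (simp add: fact_numeral)
  also have "\<dots> \<le> fact n"
    using assms by (rule fact_mono)
  finally have "vertex_pancyclic (with_proj (derangement_graph n))"
    using derangement_graph_cycle_through[OF assms]
    by (auto simp: vertex_pancyclic_def card_pverts_derangement_graph)
  \<comment> \<open>Some vertex is needed to pass from cycles through each vertex to the mere
    existence of cycles.\<close>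
  moreover have "id \<in> pverts (derangement_graph n)"
    by (simp add: derangement_graph_def cayley_graph_def sym_group_def permutes_id)
  ultimately show ?thesis
    unfolding vertex_pancyclic_def pancyclic_def by (metis with_proj_simps(1))
qed

end
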